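(* Let $r\ge1$. (i) Let the functions $f,g\colon\mathbb R^d\to\mathbb R$ be $r$-times differentiable at $\boldsymbol c\in\mathbb R^d$. Then the $r$th derivative of $f\cdot g$ at $\boldsymbol c$ is $$\mathsf D^{\otimes r}(f\cdot g)(\boldsymbol c)=\boldsymbol{\mathcal S}_{d,r}\sum_{j=0}^r\binom rj\,\mathsf D^{\otimes (r-j)}f(\boldsymbol c)\otimes\mathsf D^{\otimes j}g(\boldsymbol c)\in\mathbb R^{d^r}.$$ (ii) Let the functions $\boldsymbol f\colon\mathbb R^d\to\mathbb R^p$ and $\boldsymbol g\colon\mathbb R^d\to\mathbb R^q$ be $r$-times differentiable at $\boldsymbol c$. Then the $r$th derivative of $\boldsymbol f\otimes\boldsymbol g$ at $\boldsymbol c$ is $$\mathsf D^{\otimes r}(\boldsymbol f\otimes\boldsymbol g)(\boldsymbol c)=(\mathbf I_{pq}\otimes\boldsymbol{\mathcal S}_{d,r})\sum_{j=0}^r\binom rj\operatorname{vec}\big\{\operatorname{vec}^{-1}_{d^{r-j},p}\mathsf D^{\otimes(r-j)}\boldsymbol f(\boldsymbol c)\otimes\operatorname{vec}^{-1}_{d^j,q}\mathsf D^{\otimes j}\boldsymbol g(\boldsymbol c)\big\}\in\mathbb R^{pqd^r}.$$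
   Context: Vectors are column vectors; $\mathcal M_{m\times n}$ is the set of real $m\times n$ matrices; $\mathbf I_n$ is the $n\times n$ identity; $\otimes$ is the Kronecker product, and $(\boldsymbol f\otimes\boldsymbol g)(\boldsymbol x)=\boldsymbol f(\boldsymbol x)\otimes\boldsymbol g(\boldsymbol x)$. $\operatorname{vec}$ stacks the columns of a matrix underneath each other, and $\operatorname{vec}^{-1}_{m,n}\colon\mathbb R^{mn}\to\mathcal M_{m\times n}$ is the inverse of $\operatorname{vec}\colon\mathcal M_{m\times n}\to\mathbb R^{mn}$. Differentiability: a real function $f$ on $\mathbb R^d$ is once differentiable at $\boldsymbol c$ in the usual (Fréchet) sense; for $r>1$, it is $r$ times differentiable at $\boldsymbol c$ if it is $(r-1)$ times differentiable in a neighborhood of $\boldsymbol c$ and all its partial derivatives of order $r-1$ are differentiable at $\boldsymbol c$. A vector-valued function is $r$ times differentiable if all its components are. For scalar $f$, $\mathsf D^{\otimes r}f(\boldsymbol c)\in\mathbb R^{d^r}$ is the vector whose entry at position $1+\sum_{j=1}^r(i_j-1)d^{r-j}$ is $\frac{\partial^r f}{\partial x_{i_1}\cdots\partial x_{i_r}}(\boldsymbol c)$. For $\boldsymbol f=(f_1,\dots,f_p)$, $\mathsf D^{\otimes r}\boldsymbol f(\boldsymbol c)\in\mathbb R^{pd^r}$ is obtained by stacking $\mathsf D^{\otimes r}f_1(\boldsymbol c),\dots,\mathsf D^{\otimes r}f_p(\boldsymbol c)$ underneath each other. $\mathsf D^{\otimes 0}$ is the identity: $\mathsf D^{\otimes0}\boldsymbol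 f=\boldsymbol f$. Symmetrizer matrix: $\boldsymbol{\mathcal S}_{d,r}$ is the $d^r\times d^r$ matrix determined by $r!\,\boldsymbol{\mathcal S}_{d,r}(\boldsymbol v_1\otimes\cdots\otimes\boldsymbol v_r)=\sum_{\sigma\in\mathcal P_r}\boldsymbol v_{\sigma(1)}\otimes\cdots\otimes\boldsymbol v_{\sigma(r)}$ for all $\boldsymbol v_1,\dots,\boldsymbol v_r\in\mathbb R^d$, where $\mathcal P_r$ is the set of all permutations of $\{1,\dots,r\}$. *)

theory Defs
  imports "HOL-Analysis.Analysis" "Jordan_Normal_Form.Matrix"
begin

unbundle no vec_syntax

(* Points of R^d live in the type real^'d with d = CARD('d), which carries the library's topology
   and differential calculus.  All other vectors and matrices, whose sizes (such as d^r) depend on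
   the order r, live in the carrier-based types real Matrix.vec and real mat.  All indices below
   start at 0, not at 1. *)

section \<open>Kronecker products and vectorization\<close>

definition kron_vec :: "real Matrix.vec \<Rightarrow> real Matrix.vec \<Rightarrow> real Matrix.vec"
    (infixr \<open>\<otimes>\<^sub>v\<close> 75) where
  "u \<otimes>\<^sub>v v = Matrix.vec (dim_vec u * dim_vec v)
     (\<lambda>k. u $ (k div dim_vec v) * v $ (k mod dim_vec v))"

definition kron_mat :: "real mat \<Rightarrow> real mat \<Rightarrow> real mat" (infixr \<open>\<otimes>\<^sub>m\<close> 75) where
  "A \<otimes>\<^sub>m B = Matrix.mat (dim_row A * dim_row B) (dim_col A * dim_col B)
     (\<lambda>(i, j). A $$ (i div dim_row B, j div dim_col B) * B $$ (i mod dim_row B, j mod dim_col B))"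

definition kron_list :: "real Matrix.vec list \<Rightarrow> real Matrix.vec" where
  "kron_list vs = foldr (\<otimes>\<^sub>v) vs (Matrix.vec 1 (\<lambda>_. 1))"

definition vec_of_mat :: "real mat \<Rightarrow> real Matrix.vec" where
  "vec_of_mat A = Matrix.vec (dim_row A * dim_col A)
     (\<lambda>k. A $$ (k mod dim_row A, k div dim_row A))"

definition mat_of_vec :: "nat \<Rightarrow> nat \<Rightarrow> real Matrix.vec \<Rightarrow> real mat" where
  "mat_of_vec m n = inv_into (carrier_mat m n) vec_of_mat"

lemma index_stack_less:
  fixes i j m n :: nat
  assumes "i < m" "j < n"
  shows "j * m + i < m * n"
proof -
  have "j * m + i < Suc j * m" using assms by simp
  also have "\<dots> \<le> n * m" using assms by (intro mult_right_mono) auto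
  finally show ?thesis by (simp add: mult.commute)
qed

lemma div_less_mult:
  fixes k m n :: nat
  assumes "k < m * n"
  shows "k div n < m" "k mod n < n"
proof -
  show "k div n < m" using assms by (rule less_mult_imp_div_less)
  have "n > 0" using assms by (cases n) auto
  then show "k mod n < n" by simp
qed

lemma bij_betw_vec_of_mat: "bij_betw vec_of_mat (carrier_mat m n) (carrier_vec (m * n))"
  and mat_of_vec_eq: "v \<in> carrier_vec (m * n) \<Longrightarrow>
    mat_of_vec m n v = Matrix.mat m n (\<lambda>(i, j). v $ (j * m + i))"
proof -
  let ?g = "\<lambda>v :: real Matrix.vec. Matrix.mat m n (\<lambda>(i, j). v $ (j * m + i))"
  have gf: "?g (vec_of_mat A) = A" if A: "A \<in> carrier_mat m n" for A
  proof (rule eq_matI)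
    fix i j assume "i < dim_row A" "j < dim_col A"
    then have ij: "i < m" "j < n" using A by auto
    have "j * m + i < m * n" using index_stack_less[OF ij] .
    then show "?g (vec_of_mat A) $$ (i, j) = A $$ (i, j)"
      using A ij by (simp add: vec_of_mat_def)
  qed (use A in auto)
  have fg: "vec_of_mat (?g v) = v" if v: "v \<in> carrier_vec (m * n)" for v
  proof (rule eq_vecI)
    fix k assume "k < dim_vec v"
    then have k: "k < m * n" using v by auto
    then have "k div m < n" "k mod m < m" using div_less_mult[of k n m] by (auto simp: mult.commute)
    then show "vec_of_mat (?g v) $ k = v $ k" using k by (simp add: vec_of_mat_def)
  qed (use v in \<open>auto simp: vec_of_mat_def\<close>)
  show bij: "bij_betw vec_of_mat (carrier_mat m n) (carrier_vec (m * n))"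
  proof (rule bij_betw_byWitness[where f' = ?g])
    show "\<forall>A\<in>carrier_mat m n. ?g (vec_of_mat A) = A" using gf by blast
    show "\<forall>v\<in>carrier_vec (m * n). vec_of_mat (?g v) = v" using fg by blast
    show "vec_of_mat ` carrier_mat m n \<subseteq> carrier_vec (m * n)"
      by (auto simp: vec_of_mat_def)
    show "?g ` carrier_vec (m * n) \<subseteq> carrier_mat m n" by auto
  qed
  show "mat_of_vec m n v = ?g v" if v: "v \<in> carrier_vec (m * n)"
    using inv_into_f_f[OF bij_betw_imp_inj_on[OF bij] mat_carrier] fg[OF v]
    unfolding mat_of_vec_def by metis
qed


section \<open>Partial derivatives and differentiability of order r\<close>

(* the (i+1)-st coordinate direction *)
definition coord :: "nat \<Rightarrow> 'd::{finite, linorder}" where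
  "coord i = sorted_list_of_set UNIV ! i"

lemma bij_betw_coord: "bij_betw coord {..<CARD('d)} (UNIV :: 'd::{finite, linorder} set)"
proof -
  let ?l = "sorted_list_of_set (UNIV :: 'd set)"
  have "(coord :: nat \<Rightarrow> 'd) = (!) ?l" by (simp add: fun_eq_iff coord_def)
  moreover have "bij_betw ((!) ?l) {..<CARD('d)} UNIV"
    by (rule bij_betw_nth) simp_all
  ultimately show ?thesis by simp
qed

lemma coord_less_iff:
  assumes "i < CARD('d)" "j < CARD('d)"
  shows "(coord i :: 'd::{finite, linorder}) < coord j \<longleftrightarrow> i < j"
proof -
  let ?l = "sorted_list_of_set (UNIV :: 'd set)"
  have s: "sorted_wrt (<) ?l" by simp
  have l: "length ?l = CARD('d)" by simp
  have *: "?l ! a < ?l ! b" if "a < b" "b < CARD('d)" for a b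
    using sorted_wrt_nth_less[OF s that(1)] that(2) l by simp
  show ?thesis unfolding coord_def
    using *[of i j] *[of j i] assms by (metis less_asym less_irrefl nat_neq_iff)
qed

definition partial_deriv :: "'d::finite \<Rightarrow> (real^'d \<Rightarrow> real) \<Rightarrow> real^'d \<Rightarrow> real" where
  "partial_deriv i f x = deriv (\<lambda>t. f (x + t *\<^sub>R axis i 1)) 0"

definition mixed_partial :: "'d::finite list \<Rightarrow> (real^'d \<Rightarrow> real) \<Rightarrow> real^'d \<Rightarrow> real" where
  "mixed_partial is f = foldr partial_deriv is f"

(* For n = 0 the neighbourhood condition is vacuous and mixed_partial [] f = f, so that order 1 is
   Frechet differentiability at c. *)
primrec times_differentiable_at :: "nat \<Rightarrow> (real^'d::finite \<Rightarrow> real) \<Rightarrow> real^'d \<Rightarrow> bool" where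
  "times_differentiable_at 0 f c \<longleftrightarrow> True"
| "times_differentiable_at (Suc n) f c \<longleftrightarrow>
     (\<forall>\<^sub>F x in nhds c. times_differentiable_at n f x) \<and>
     (\<forall>is. length is = n \<longrightarrow> mixed_partial is f differentiable (at c))"

lemma times_differentiable_at_1: "times_differentiable_at 1 f c \<longleftrightarrow> f differentiable (at c)"
  by (simp add: mixed_partial_def)

definition vec_times_differentiable_at ::
    "nat \<Rightarrow> nat \<Rightarrow> (real^'d::finite \<Rightarrow> real Matrix.vec) \<Rightarrow> real^'d \<Rightarrow> bool" where
  "vec_times_differentiable_at p r F c \<longleftrightarrow>
     (\<forall>k<p. times_differentiable_at r (\<lambda>x. F x $ k) c)"

(* the base-d digits (i_1, ..., i_r) of k = i_1 d^(r-1) + ... + i_r d^0 *)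
definition multi_index :: "nat \<Rightarrow> nat \<Rightarrow> nat \<Rightarrow> nat list" where
  "multi_index d r k = map (\<lambda>j. k div d ^ (r - j) mod d) [1..<Suc r]"

definition tensor_deriv ::
    "nat \<Rightarrow> (real^'d::{finite, linorder} \<Rightarrow> real) \<Rightarrow> real^'d::{finite, linorder} \<Rightarrow> real Matrix.vec" where
  "tensor_deriv r f c = Matrix.vec (CARD('d) ^ r)
     (\<lambda>k. mixed_partial (map coord (multi_index CARD('d) r k)) f c)"

definition vec_tensor_deriv ::
    "nat \<Rightarrow> nat \<Rightarrow> (real^'d::{finite, linorder} \<Rightarrow> real Matrix.vec) \<Rightarrow> real^'d::{finite, linorder} \<Rightarrow> real Matrix.vec" where
  "vec_tensor_deriv p r F c = Matrix.vec (p * CARD('d) ^ r)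
     (\<lambda>k. tensor_deriv r (\<lambda>x. F x $ (k div CARD('d) ^ r)) c $ (k mod CARD('d) ^ r))"

lemma tensor_deriv_0: "tensor_deriv 0 f c = Matrix.vec 1 (\<lambda>_. f c)"
  by (auto simp: tensor_deriv_def multi_index_def mixed_partial_def)

lemma vec_tensor_deriv_0: "F c \<in> carrier_vec p \<Longrightarrow> vec_tensor_deriv p 0 F c = F c"
  by (auto simp: vec_tensor_deriv_def tensor_deriv_0)

lemma multi_index_0 [simp]: "multi_index d 0 k = []"
  by (simp add: multi_index_def)

lemma length_multi_index [simp]: "length (multi_index d r k) = r"
  by (simp add: multi_index_def)

lemma multi_index_Suc:
  "multi_index d (Suc r) k = (k div d ^ r mod d) # multi_index d r (k mod d ^ r)"
proof (rule nth_equalityI)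
  fix i assume "i < length (multi_index d (Suc r) k)"
  then have i: "i < Suc r" by simp
  show "multi_index d (Suc r) k ! i = ((k div d ^ r mod d) # multi_index d r (k mod d ^ r)) ! i"
  proof (cases i)
    case 0
    then show ?thesis by (simp add: multi_index_def del: upt_Suc)
  next
    case (Suc j)
    let ?s = "r - Suc j"
    have e: "d ^ r = d ^ ?s * d ^ Suc j"
      using i Suc by (simp flip: power_add power_Suc)
    have "k mod d ^ r div d ^ ?s mod d = k div d ^ ?s mod d"
    proof (cases "d = 0")
      case False
      have "k mod d ^ r = d ^ ?s * (k div d ^ ?s mod d ^ Suc j) + k mod d ^ ?s"
        unfolding e by (rule mod_mult2_eq)
      then have "k mod d ^ r div d ^ ?s = k div d ^ ?s mod d ^ Suc j"
        using False by simp
      then show ?thesis by (simp add: mod_mod_cancel)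
    next
      case True
      then show ?thesis using i Suc by (cases r) auto
    qed
    then show ?thesis using i Suc by (simp add: multi_index_def del: upt_Suc)
  qed
qed simp

lemma set_multi_index: "k < d ^ r \<Longrightarrow> set (multi_index d r k) \<subseteq> {..<d}"
  by (cases "d = 0"; cases r) (auto simp: multi_index_def)

lemma multi_index_encode:
  assumes "set is \<subseteq> {..<d}"
  shows "(\<Sum>j<length is. is ! j * d ^ (length is - Suc j)) < d ^ length is"
    and "multi_index d (length is) (\<Sum>j<length is. is ! j * d ^ (length is - Suc j)) = is"
  using assms
proof (induction "is")
  case Nil
  { case 1 show ?case by simp next case 2 show ?case by simp }
next
  case (Cons i "is")
  let ?e = "\<Sum>j<length is. is ! j * d ^ (length is - Suc j)"
  have e: "(\<Sum>j<length (i # is). (i # is) ! j * d ^ (length (i # is) - Suc j))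
      = i * d ^ length is + ?e"
    by (simp add: sum.lessThan_Suc_shift del: sum.lessThan_Suc)
  { case 1
    then have "?e < d ^ length is" "i < d" using Cons.IH(1) by auto
    then show ?case unfolding e using index_stack_less[of ?e "d ^ length is" i d]
      by (simp add: mult.commute)
  next
    case 2
    then have "?e < d ^ length is" "i < d" "multi_index d (length is) ?e = is"
      using Cons.IH by auto
    then show ?case unfolding e by (simp add: multi_index_Suc) }
qed

lemma multi_index_inj:
  "k < d ^ r \<Longrightarrow> l < d ^ r \<Longrightarrow> multi_index d r k = multi_index d r l \<Longrightarrow> k = l"
proof (induction r arbitrary: k l)
  case (Suc r)
  have pos: "d ^ r > 0" using Suc.prems(1) by (cases "d = 0") auto
  have "k div d ^ r < d" "l div d ^ r < d"
    using Suc.prems(1,2) by (auto intro: less_mult_imp_div_less)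
  moreover have "k div d ^ r mod d = l div d ^ r mod d"
    "multi_index d r (k mod d ^ r) = multi_index d r (l mod d ^ r)"
    using Suc.prems(3) by (simp_all add: multi_index_Suc)
  ultimately have "k div d ^ r = l div d ^ r" "k mod d ^ r = l mod d ^ r"
    using Suc.IH[of "k mod d ^ r" "l mod d ^ r"] pos by auto
  then show ?case by (metis div_mult_mod_eq)
qed simp

lemma tensor_deriv_index:
  fixes f :: "real^'d::{finite, linorder} \<Rightarrow> real"
  assumes "length is = r" "set is \<subseteq> {..<CARD('d)}"
  shows "tensor_deriv r f c $ (\<Sum>j<r. is ! j * CARD('d) ^ (r - Suc j))
    = mixed_partial (map coord is) f c"
  using multi_index_encode[OF assms(2)] assms(1) by (simp add: tensor_deriv_def)


section \<open>The symmetrizer matrix\<close>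

definition is_symmetrizer :: "nat \<Rightarrow> nat \<Rightarrow> real mat \<Rightarrow> bool" where
  "is_symmetrizer d r S \<longleftrightarrow> S \<in> carrier_mat (d ^ r) (d ^ r) \<and>
     (\<forall>vs. length vs = r \<and> set vs \<subseteq> carrier_vec d \<longrightarrow>
        fact r \<cdot>\<^sub>v (S *\<^sub>v kron_list vs) =
        finsum_vec TYPE(real) (d ^ r) (\<lambda>\<sigma>. kron_list (map (\<lambda>j. vs ! \<sigma> j) [0..<r]))
          {\<sigma>. \<sigma> permutes {0..<r}})"

definition symmetrizer :: "nat \<Rightarrow> nat \<Rightarrow> real mat" where
  "symmetrizer d r = (THE S. is_symmetrizer d r S)"

lemma kron_list_index:
  assumes "set vs \<subseteq> carrier_vec d"
  shows "kron_list vs \<in> carrier_vec (d ^ length vs)"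
    and "k < d ^ length vs \<Longrightarrow>
      kron_list vs $ k = (\<Prod>j<length vs. vs ! j $ (multi_index d (length vs) k ! j))"
  using assms
proof (induction vs arbitrary: k)
  case Nil
  { case 1 show ?case by (simp add: kron_list_def) next case 2 then show ?case by (simp add: kron_list_def) }
next
  case (Cons v vs)
  let ?n = "d ^ length vs"
  have e: "kron_list (v # vs) = v \<otimes>\<^sub>v kron_list vs" by (simp add: kron_list_def)
  { case 1
    then have "dim_vec v = d" "dim_vec (kron_list vs) = ?n" using Cons.IH(1) by auto
    then show ?case unfolding e by (auto simp: kron_vec_def)
  next
    case 2
    then have d: "dim_vec v = d" "dim_vec (kron_list vs) = ?n" "set vs \<subseteq> carrier_vec d"
      using Cons.IH(1) by auto
    have k: "k < d * ?n" using 2 by simp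
    then have k': "k div ?n < d" "k mod ?n < ?n" using div_less_mult[of k d ?n] by auto
    have "kron_list (v # vs) $ k = v $ (k div ?n) * kron_list vs $ (k mod ?n)"
      unfolding e using k d by (simp add: kron_vec_def)
    also have "\<dots> = (\<Prod>j<length (v # vs). (v # vs) ! j $ (multi_index d (length (v # vs)) k ! j))"
      using Cons.IH(2)[OF k'(2) d(3)] k'
      by (simp add: prod.lessThan_Suc_shift multi_index_Suc del: prod.lessThan_Suc)
    finally show ?case . }
qed

lemma ex1_is_symmetrizer: "\<exists>!S. is_symmetrizer d r S"
proof -
  let ?P = "{\<sigma>. \<sigma> permutes {0..<r}}"
  let ?m = "multi_index d r"
  have finP: "finite ?P" by (rule finite_permutations) simp
  define ind :: "(nat \<Rightarrow> nat) \<Rightarrow> nat \<Rightarrow> nat \<Rightarrow> real" where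
    "ind \<sigma> a b = (if \<forall>j<r. ?m b ! \<sigma> j = ?m a ! j then 1 else 0)" for \<sigma> a b
  define S where "S = Matrix.mat (d ^ r) (d ^ r) (\<lambda>(a, b). (\<Sum>\<sigma>\<in>?P. ind \<sigma> a b) / fact r)"
  have Sc: "S \<in> carrier_mat (d ^ r) (d ^ r)" by (simp add: S_def)
  have "is_symmetrizer d r S"
    unfolding is_symmetrizer_def
  proof (intro conjI allI impI Sc)
    fix vs :: "real Matrix.vec list"
    assume vs: "length vs = r \<and> set vs \<subseteq> carrier_vec d"
    have Kc: "kron_list vs \<in> carrier_vec (d ^ r)"
      and K: "\<And>k. k < d ^ r \<Longrightarrow> kron_list vs $ k = (\<Prod>j<r. vs ! j $ (?m k ! j))"
      using kron_list_index[of vs d] vs by auto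
    let ?perm = "\<lambda>\<sigma>. map (\<lambda>j. vs ! \<sigma> j) [0..<r]"
    have setp: "set (?perm \<sigma>) \<subseteq> carrier_vec d" if "\<sigma> \<in> ?P" for \<sigma>
      using that vs permutes_in_image[of \<sigma> "{0..<r}"] by (fastforce simp: subset_iff)
    have Lc: "(\<lambda>\<sigma>. kron_list (?perm \<sigma>)) \<in> ?P \<rightarrow> carrier_vec (d ^ r)"
      using kron_list_index(1)[OF setp] by auto
    show "fact r \<cdot>\<^sub>v (S *\<^sub>v kron_list vs) = finsum_vec TYPE(real) (d ^ r) (\<lambda>\<sigma>. kron_list (?perm \<sigma>)) ?P"
    proof (rule eq_vecI)
      fix a assume "a < dim_vec (finsum_vec TYPE(real) (d ^ r) (\<lambda>\<sigma>. kron_list (?perm \<sigma>)) ?P)"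
      then have a: "a < d ^ r" using finsum_vec_closed[OF Lc] by auto
      have key: "(\<Sum>b<d ^ r. ind \<sigma> a b * kron_list vs $ b) = kron_list (?perm \<sigma>) $ a"
        if s: "\<sigma> \<in> ?P" for \<sigma>
      proof -
        have per: "\<sigma> permutes {0..<r}" using s by simp
        let ?inv = "inv_into UNIV \<sigma>"
        define bs where "bs = map (\<lambda>i. ?m a ! ?inv i) [0..<r]"
        define b0 where "b0 = (\<Sum>j<r. bs ! j * d ^ (r - Suc j))"
        have iper: "?inv i < r" if "i < r" for i
          using permutes_in_image[OF permutes_inv[OF per], of i] that by simp
        have sper: "\<sigma> i < r" if "i < r" for i
          using permutes_in_image[OF per, of i] that by simp
        have "set bs \<subseteq> {..<d}" unfolding bs_def
          using set_multi_index[OF a] iper by (auto simp: subset_iff)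
        from multi_index_encode[OF this] have b0: "b0 < d ^ r" "?m b0 = bs"
          by (simp_all add: b0_def bs_def)
        have ind: "ind \<sigma> a b = (if b = b0 then 1 else 0)" if b: "b < d ^ r" for b
        proof -
          have "(\<forall>j<r. ?m b ! \<sigma> j = ?m a ! j) \<longleftrightarrow> ?m b = bs"
          proof
            assume h: "\<forall>j<r. ?m b ! \<sigma> j = ?m a ! j"
            show "?m b = bs"
            proof (rule nth_equalityI)
              fix i assume "i < length (?m b)"
              then have i: "i < r" by simp
              then have "?m b ! \<sigma> (?inv i) = ?m a ! ?inv i" using h iper by blast
              then show "?m b ! i = bs ! i" using i permutes_inverses(1)[OF per] by (simp add: bs_def)
            qed (simp add: bs_def)
          next
            assume "?m b = bs"
            then show "\<forall>j<r. ?m b ! \<sigma> j = ?m a ! j"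
              using sper permutes_inverses(2)[OF per] by (simp add: bs_def)
          qed
          also have "\<dots> \<longleftrightarrow> b = b0" using multi_index_inj[OF b b0(1)] b0 by auto
          finally show ?thesis by (simp add: ind_def)
        qed
        have "(\<Sum>b<d ^ r. ind \<sigma> a b * kron_list vs $ b)
            = (\<Sum>b<d ^ r. if b = b0 then kron_list vs $ b else 0)"
          by (rule sum.cong) (auto simp: ind)
        also have "\<dots> = kron_list vs $ b0" using b0 by (simp add: sum.delta)
        also have "\<dots> = (\<Prod>j<r. vs ! j $ (bs ! j))" using K[OF b0(1)] b0 by simp
        also have "\<dots> = (\<Prod>j\<in>{0..<r}. vs ! \<sigma> j $ (bs ! \<sigma> j))"
          using prod.permute[OF per, of "\<lambda>j. vs ! j $ (bs ! j)"] by (simp add: atLeast0LessThan o_def)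
        also have "\<dots> = (\<Prod>j<r. vs ! \<sigma> j $ (?m a ! j))"
          using sper permutes_inverses(2)[OF per] by (simp add: bs_def atLeast0LessThan)
        also have "\<dots> = kron_list (?perm \<sigma>) $ a"
          using kron_list_index(2)[OF setp[OF s], of a] a by simp
        finally show ?thesis .
      qed
      have "(fact r \<cdot>\<^sub>v (S *\<^sub>v kron_list vs)) $ a = fact r * (\<Sum>b<d ^ r. S $$ (a, b) * kron_list vs $ b)"
        using a Sc Kc by (simp add: scalar_prod_def atLeast0LessThan)
      also have "\<dots> = (\<Sum>b<d ^ r. \<Sum>\<sigma>\<in>?P. ind \<sigma> a b * kron_list vs $ b)"
        using a by (simp add: S_def sum_distrib_left sum_distrib_right sum_divide_distrib)
      also have "\<dots> = (\<Sum>\<sigma>\<in>?P. \<Sum>b<d ^ r. ind \<sigma> a b * kron_list vs $ b)"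
        by (rule sum.swap)
      also have "\<dots> = (\<Sum>\<sigma>\<in>?P. kron_list (?perm \<sigma>) $ a)"
        using key by (intro sum.cong) auto
      also have "\<dots> = finsum_vec TYPE(real) (d ^ r) (\<lambda>\<sigma>. kron_list (?perm \<sigma>)) ?P $ a"
        by (rule index_finsum_vec[symmetric, OF finP a Lc])
      finally show "(fact r \<cdot>\<^sub>v (S *\<^sub>v kron_list vs)) $ a = \<dots>" .
    qed (use finsum_vec_closed[OF Lc] Sc in auto)
  qed
  moreover have "A = B" if A: "is_symmetrizer d r A" and B: "is_symmetrizer d r B" for A B
  proof (rule eq_matI)
    have Ac: "A \<in> carrier_mat (d ^ r) (d ^ r)" and Bc: "B \<in> carrier_mat (d ^ r) (d ^ r)"
      using A B by (auto simp: is_symmetrizer_def)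
    fix a b assume "a < dim_row B" "b < dim_col B"
    then have a: "a < d ^ r" and b: "b < d ^ r" using Bc by auto
    let ?vs = "map (unit_vec d) (?m b) :: real Matrix.vec list"
    have vs: "length ?vs = r" "set ?vs \<subseteq> carrier_vec d" by auto
    have dig: "?m k ! j < d" if "k < d ^ r" "j < r" for k j
      using set_multi_index[OF that(1)] that(2) by (metis length_multi_index lessThan_iff nth_mem subsetD)
    have U: "kron_list ?vs = unit_vec (d ^ r) b"
    proof (rule eq_vecI)
      fix k assume "k < dim_vec (unit_vec (d ^ r) b :: real Matrix.vec)"
      then have k: "k < d ^ r" by simp
      have "kron_list ?vs $ k = (\<Prod>j<r. ?vs ! j $ (?m k ! j))"
        using kron_list_index(2)[OF vs(2), of k] k by simp
      also have "\<dots> = (\<Prod>j<r. if ?m k ! j = ?m b ! j then 1 else 0)"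
        using dig[OF k] dig[OF b] by (intro prod.cong) auto
      also have "\<dots> = (if k = b then 1 else 0)"
      proof (cases "k = b")
        case False
        then have "?m k \<noteq> ?m b" using multi_index_inj[OF k b] by blast
        then obtain j where "j < r" "?m k ! j \<noteq> ?m b ! j"
          by (metis length_multi_index nth_equalityI)
        then show ?thesis using False by (auto intro!: prod_zero)
      qed simp
      finally show "kron_list ?vs $ k = unit_vec (d ^ r) b $ k" using k b by simp
    qed (use kron_list_index(1)[OF vs(2)] in auto)
    have "fact r \<cdot>\<^sub>v (A *\<^sub>v kron_list ?vs) = fact r \<cdot>\<^sub>v (B *\<^sub>v kron_list ?vs)"
      using A B vs by (simp add: is_symmetrizer_def)
    then have "(fact r \<cdot>\<^sub>v (A *\<^sub>v unit_vec (d ^ r) b)) $ a = (fact r \<cdot>\<^sub>v (B *\<^sub>v unit_vec (d ^ r) b)) $ a"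
      by (simp add: U)
    then show "A $$ (a, b) = B $$ (a, b)"
      using Ac Bc a b by simp
  qed (use A B in \<open>auto simp: is_symmetrizer_def\<close>)
  ultimately show ?thesis by blast
qed

lemma is_symmetrizer_symmetrizer: "is_symmetrizer d r (symmetrizer d r)"
  unfolding symmetrizer_def by (rule theI'[OF ex1_is_symmetrizer])

end

theory Submission
  imports Defs
begin

text \<open>Differentiating \<open>f \<cdot> g\<close> in the directions \<open>i\<^sub>1, \<dots>, i\<^sub>r\<close> gives the Leibniz sum over all sets \<open>T\<close> of positions,
where the derivatives at the positions in \<open>T\<close> fall on \<open>g\<close> and the others on \<open>f\<close>
(\<open>mixed_partial_mult\<close>). The symmetrizer averages the entries of a vector over all permutations of the
\<open>r\<close> digits of their index (\<open>symmetrizer_mult_vec\<close>). In the \<open>j\<close>-th summand of the formula the derivatives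
of \<open>g\<close> occupy the last \<open>j\<close> digits, and a permutation \<open>\<sigma>\<close> moves these to the set \<open>\<sigma> ` {r - j..<r}\<close>. A uniformly
random permutation takes this set to a uniformly random \<open>j\<close>-element set, and there are \<open>r choose j\<close> of those
(\<open>sum_permutations_image\<close>), so the average of \<open>r choose j\<close> times the \<open>j\<close>-th summand is the part of the Leibniz sum
with \<open>j\<close> derivatives on \<open>g\<close>. Summing over \<open>j\<close> gives the scalar formula.

A permutation also changes the order of the derivatives within each factor. That mixed partial derivatives
do not depend on this order (\<open>mixed_partial_cong_mset\<close>) is the analytic part. The derivatives of the highest order are only known
to exist at one point, so it rests on Young's form of the symmetry theorem (\<open>young_mixed_partials\<close>), which compares both second derivatives with one symmetric
difference quotient.

The formula for vector-valued functions is the scalar one in each component: the columns of the Kronecker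
product of the reshaped derivatives are the Kronecker products for pairs of components, and
\<open>1\<^sub>m (p * q) \<otimes>\<^sub>m symmetrizer d r\<close> symmetrizes each column separately.\<close>

section \<open>Calculus of partial derivatives\<close>

lemma tendsto_line_nhds:
  fixes x v :: "'a::real_normed_vector"
  shows "((\<lambda>t::real. x + t *\<^sub>R v) \<longlongrightarrow> x) (nhds 0)"
proof -
  have "isCont (\<lambda>t::real. x + t *\<^sub>R v) 0" by (intro continuous_intros)
  then show ?thesis using tendsto_at_iff_tendsto_nhds[of "\<lambda>t::real. x + t *\<^sub>R v" 0] by (simp add: isCont_def)
qed

lemma has_real_derivative_along_line:
  fixes f :: "'a::real_normed_vector \<Rightarrow> real"
  assumes "(f has_derivative D) (at (x + s *\<^sub>R v))"
  shows "((\<lambda>t. f (x + t *\<^sub>R v)) has_real_derivative D v) (at s)"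
proof -
  interpret bounded_linear D by (rule has_derivative_bounded_linear[OF assms])
  have "((\<lambda>t. x + t *\<^sub>R v) has_derivative (\<lambda>t. t *\<^sub>R v)) (at s)"
    by (auto intro!: derivative_eq_intros)
  from diff_chain_at[OF this assms]
  have "((\<lambda>t. f (x + t *\<^sub>R v)) has_derivative (\<lambda>t. D (t *\<^sub>R v))) (at s)"
    by (simp add: o_def)
  then show ?thesis by (simp add: has_field_derivative_def scaleR mult.commute[of _ "D v"] cong: if_cong)
qed

lemma partial_deriv_eq_derivative:
  assumes "(f has_derivative D) (at x)"
  shows "partial_deriv i f x = D (axis i 1)"
  unfolding partial_deriv_def
  by (rule DERIV_imp_deriv, rule has_real_derivative_along_line) (use assms in simp)

lemma has_partial_deriv_along_axis:
  assumes "f differentiable (at (x + s *\<^sub>R axis i 1))"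
  shows "((\<lambda>t. f (x + t *\<^sub>R axis i 1)) has_real_derivative
    partial_deriv i f (x + s *\<^sub>R axis i 1)) (at s)"
  using assms has_real_derivative_along_line partial_deriv_eq_derivative
  unfolding differentiable_def by metis

text \<open>Differentiability of order \<open>n + 1\<close> at a point says that differentiability of order \<open>n\<close> holds near
it, so every induction on the order yields its hypothesis only near the point. This lemma turns such
an identity of functions near the point into one for their partial derivatives.\<close>

lemma partial_deriv_cong_nhds:
  assumes "\<forall>\<^sub>F y in nhds x. f y = g y"
  shows "partial_deriv i f x = partial_deriv i g x"
  unfolding partial_deriv_def
  by (rule deriv_cong_ev[OF eventually_compose_filterlim[OF assms tendsto_line_nhds] refl])

lemma partial_deriv_mult:
  assumes "f differentiable (at x)" "g differentiable (at x)"
  shows "partial_deriv i (\<lambda>x. f x * g x) x =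
    partial_deriv i f x * g x + f x * partial_deriv i g x"
proof -
  obtain D E where D: "(f has_derivative D) (at x)" and E: "(g has_derivative E) (at x)"
    using assms by (auto simp: differentiable_def)
  show ?thesis
    using partial_deriv_eq_derivative[OF has_derivative_mult[OF D E]]
    by (simp add: partial_deriv_eq_derivative[OF D] partial_deriv_eq_derivative[OF E])
qed

lemma partial_deriv_sum:
  assumes "\<And>a. a \<in> A \<Longrightarrow> f a differentiable (at x)"
  shows "partial_deriv i (\<lambda>x. \<Sum>a\<in>A. f a x) x = (\<Sum>a\<in>A. partial_deriv i (f a) x)"
proof -
  obtain D where D: "\<And>a. a \<in> A \<Longrightarrow> (f a has_derivative D a) (at x)"
    using assms unfolding differentiable_def by metis
  show ?thesis
    using partial_deriv_eq_derivative[OF has_derivative_sum[of A f D, OF D]]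
    by (simp add: partial_deriv_eq_derivative[OF D])
qed

lemma mixed_partial_Nil [simp]: "mixed_partial [] f = f"
  and mixed_partial_Cons [simp]: "mixed_partial (i # is) f = partial_deriv i (mixed_partial is f)"
  by (simp_all add: mixed_partial_def)

lemma times_differentiable_at_mono:
  assumes "times_differentiable_at n f x" "m \<le> n"
  shows "times_differentiable_at m f x"
  using assms(2,1)
proof (induction rule: inc_induct)
  case (step k)
  then have "times_differentiable_at (Suc k) f x" by blast
  then show ?case by (auto dest: eventually_nhds_x_imp_x)
qed

lemma mixed_partial_differentiable:
  assumes "times_differentiable_at n f x" "length is < n"
  shows "mixed_partial is f differentiable (at x)"
  using times_differentiable_at_mono[OF assms(1), of "Suc (length is)"] assms(2) by auto

text \<open>Each of the successive derivatives falls either on \<open>f\<close> or on \<open>g\<close>; \<open>T\<close> is the set of positions at which it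
falls on \<open>g\<close>. The positions are the entries of the distinct list \<open>xs\<close>, separate from the directions \<open>w\<close>,
so that repeated directions still count as different choices. When a position \<open>k\<close> is put in front, the
product rule splits each choice \<open>T\<close> into \<open>T\<close> and \<open>insert k T\<close>. Both factors keep their directions in
the original order.\<close>

lemma mixed_partial_mult:
  assumes "distinct xs" "times_differentiable_at (length xs) f x" "times_differentiable_at (length xs) g x"
  shows "mixed_partial (map w xs) (\<lambda>x. f x * g x) x =
    (\<Sum>T\<in>Pow (set xs). mixed_partial (map w (filter (\<lambda>k. k \<notin> T) xs)) f x *
       mixed_partial (map w (filter (\<lambda>k. k \<in> T) xs)) g x)"
  using assms
proof (induction xs arbitrary: x)
  case Nil
  then show ?case by simp
next
  case (Cons k xs)
  let ?F = "\<lambda>T. mixed_partial (map w (filter (\<lambda>k. k \<notin> T) xs)) f"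
  let ?G = "\<lambda>T. mixed_partial (map w (filter (\<lambda>k. k \<in> T) xs)) g"
  have "\<forall>\<^sub>F y in nhds x. times_differentiable_at (length xs) f y \<and> times_differentiable_at (length xs) g y"
    using Cons.prems by (simp add: eventually_conj_iff)
  then have ev: "\<forall>\<^sub>F y in nhds x. mixed_partial (map w xs) (\<lambda>x. f x * g x) y =
      (\<Sum>T\<in>Pow (set xs). ?F T y * ?G T y)"
    by eventually_elim (use Cons in auto)
  have le: "length (filter P xs) < length (k # xs)" for P
    by (simp add: le_imp_less_Suc)
  have dF: "?F T differentiable (at x)" and dG: "?G T differentiable (at x)" for T
    using Cons.prems(2,3) le by (auto intro!: mixed_partial_differentiable simp del: times_differentiable_at.simps)
  have k: "k \<notin> set xs" using Cons.prems by simp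
  have "mixed_partial (map w (k # xs)) (\<lambda>x. f x * g x) x =
      partial_deriv (w k) (\<lambda>y. \<Sum>T\<in>Pow (set xs). ?F T y * ?G T y) x"
    by (simp add: partial_deriv_cong_nhds[OF ev])
  also have "\<dots> = (\<Sum>T\<in>Pow (set xs). partial_deriv (w k) (?F T) x * ?G T x + ?F T x * partial_deriv (w k) (?G T) x)"
    by (simp add: partial_deriv_sum partial_deriv_mult dF dG differentiable_mult)
  also have "\<dots> = (\<Sum>T\<in>Pow (set xs). partial_deriv (w k) (?F T) x * ?G T x)
      + (\<Sum>T\<in>Pow (set xs). ?F T x * partial_deriv (w k) (?G T) x)"
    by (rule sum.distrib)
  also have "\<dots> = (\<Sum>T\<in>Pow (set xs). mixed_partial (map w (filter (\<lambda>k. k \<notin> T) (k # xs))) f x *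
       mixed_partial (map w (filter (\<lambda>k. k \<in> T) (k # xs))) g x)
    + (\<Sum>T\<in>insert k ` Pow (set xs). mixed_partial (map w (filter (\<lambda>k. k \<notin> T) (k # xs))) f x *
       mixed_partial (map w (filter (\<lambda>k. k \<in> T) (k # xs))) g x)"
  proof (rule arg_cong2[where f = "(+)"])
    show "(\<Sum>T\<in>Pow (set xs). partial_deriv (w k) (?F T) x * ?G T x) =
      (\<Sum>T\<in>Pow (set xs). mixed_partial (map w (filter (\<lambda>k. k \<notin> T) (k # xs))) f x *
       mixed_partial (map w (filter (\<lambda>k. k \<in> T) (k # xs))) g x)"
      using k by (intro sum.cong) auto
    have inj: "inj_on (insert k) (Pow (set xs))"
      using k by (auto simp: inj_on_def)
    have fil: "filter (\<lambda>l. l \<noteq> k \<and> l \<notin> T) xs = filter (\<lambda>l. l \<notin> T) xs"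
      "filter (\<lambda>l. l = k \<or> l \<in> T) xs = filter (\<lambda>l. l \<in> T) xs" for T
      using k by (auto intro!: filter_cong)
    show "(\<Sum>T\<in>Pow (set xs). ?F T x * partial_deriv (w k) (?G T) x) =
      (\<Sum>T\<in>insert k ` Pow (set xs). mixed_partial (map w (filter (\<lambda>k. k \<notin> T) (k # xs))) f x *
       mixed_partial (map w (filter (\<lambda>k. k \<in> T) (k # xs))) g x)"
      by (simp add: sum.reindex[OF inj] fil)
  qed
  also have "\<dots> = (\<Sum>T\<in>Pow (set (k # xs)). mixed_partial (map w (filter (\<lambda>k. k \<notin> T) (k # xs))) f x *
       mixed_partial (map w (filter (\<lambda>k. k \<in> T) (k # xs))) g x)"
    using k by (subst sum.union_disjoint[symmetric]) (auto simp: Pow_insert)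
  finally show ?case .
qed

section \<open>Symmetry of mixed partial derivatives\<close>

text \<open>The second difference of \<open>h\<close> over the square with sides \<open>t *\<^sub>R u\<close> and \<open>t *\<^sub>R v\<close> is the increment of
\<open>s \<mapsto> h (c + s *\<^sub>R u + t *\<^sub>R v) - h (c + s *\<^sub>R u)\<close> from \<open>0\<close> to \<open>t\<close>. By the mean value theorem it is \<open>t\<close> times
a difference of values of \<open>partial_deriv i h\<close> at two points at distance at most \<open>2 * t\<close> from \<open>c\<close>, and there
the derivative of \<open>partial_deriv i h\<close> at \<open>c\<close> approximates that function up to \<open>o(t)\<close>.\<close>

lemma second_difference_quotient_tendsto:
  fixes h :: "real^'d::finite \<Rightarrow> real" and i j :: 'd
  defines "u \<equiv> axis i (1::real)" and "v \<equiv> axis j (1::real)"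
  assumes ev: "\<forall>\<^sub>F x in nhds c. h differentiable (at x)"
    and diff: "partial_deriv i h differentiable (at c)"
  shows "((\<lambda>t. (h (c + t *\<^sub>R u + t *\<^sub>R v) - h (c + t *\<^sub>R u) - h (c + t *\<^sub>R v) + h c) / t\<^sup>2)
    \<longlongrightarrow> partial_deriv j (partial_deriv i h) c) (at_right 0)"
proof (rule tendstoI)
  let ?P = "partial_deriv i h"
  let ?q = "\<lambda>t. (h (c + t *\<^sub>R u + t *\<^sub>R v) - h (c + t *\<^sub>R u) - h (c + t *\<^sub>R v) + h c) / t\<^sup>2"
  obtain D where D: "(?P has_derivative D) (at c)"
    using diff by (auto simp: differentiable_def)
  interpret bounded_linear D by (rule has_derivative_bounded_linear[OF D])
  have Dv: "partial_deriv j ?P c = D v"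
    unfolding v_def by (rule partial_deriv_eq_derivative[OF D])
  have norm_u: "norm u = 1" and norm_v: "norm v = 1"
    by (simp_all add: u_def v_def)
  fix e :: real assume "e > 0"
  then have "e / 4 > 0" by simp
  with D obtain \<delta> where \<delta>: "\<delta> > 0"
    "\<And>y. norm (y - c) < \<delta> \<Longrightarrow> \<bar>?P y - ?P c - D (y - c)\<bar> \<le> e / 4 * norm (y - c)"
    unfolding has_derivative_at_alt real_norm_def by blast
  obtain \<epsilon> where \<epsilon>: "\<epsilon> > 0" "\<And>y. norm (y - c) < \<epsilon> \<Longrightarrow> h differentiable (at y)"
    using ev by (auto simp: eventually_nhds_metric dist_norm)
  have close: "dist (?q t) (D v) < e" if t: "0 < t" "2 * t < \<delta>" "2 * t < \<epsilon>" for t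
  proof -
    have norm_le: "norm (s *\<^sub>R u + t *\<^sub>R v) \<le> 2 * t" "norm (s *\<^sub>R u) \<le> t"
      if "0 \<le> s" "s \<le> t" for s
      using norm_triangle_ineq[of "s *\<^sub>R u" "t *\<^sub>R v"] that t by (auto simp: norm_u norm_v)
    have d1: "h differentiable (at ((c + t *\<^sub>R v) + s *\<^sub>R u))" and d2: "h differentiable (at (c + s *\<^sub>R u))"
      if "0 \<le> s" "s \<le> t" for s
      using norm_le[OF that] t by (auto intro!: \<epsilon>(2) simp: algebra_simps)
    have deriv: "((\<lambda>s. h ((c + t *\<^sub>R v) + s *\<^sub>R u) - h (c + s *\<^sub>R u)) has_real_derivative
        ?P ((c + t *\<^sub>R v) + s *\<^sub>R u) - ?P (c + s *\<^sub>R u)) (at s)" if "0 \<le> s" "s \<le> t" for s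
      using d1[OF that] d2[OF that] unfolding u_def
      by (intro DERIV_diff has_partial_deriv_along_axis)
    obtain s where s: "0 < s" "s < t" and
      "(h ((c + t *\<^sub>R v) + t *\<^sub>R u) - h (c + t *\<^sub>R u)) - (h ((c + t *\<^sub>R v) + 0 *\<^sub>R u) - h (c + 0 *\<^sub>R u))
        = (t - 0) * (?P ((c + t *\<^sub>R v) + s *\<^sub>R u) - ?P (c + s *\<^sub>R u))"
      using MVT2[OF t(1) deriv] by blast
    then have "h (c + t *\<^sub>R u + t *\<^sub>R v) - h (c + t *\<^sub>R u) - h (c + t *\<^sub>R v) + h c
        = t * (?P ((c + t *\<^sub>R v) + s *\<^sub>R u) - ?P (c + s *\<^sub>R u))"
      by (simp add: add.assoc add.commute[of "t *\<^sub>R v"])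
    then have q: "?q t = (?P ((c + t *\<^sub>R v) + s *\<^sub>R u) - ?P (c + s *\<^sub>R u)) / t"
      by (simp add: power2_eq_square)
    have "\<bar>?P ((c + t *\<^sub>R v) + s *\<^sub>R u) - ?P c - D (s *\<^sub>R u + t *\<^sub>R v)\<bar> \<le> e / 4 * norm (s *\<^sub>R u + t *\<^sub>R v)"
      using \<delta>(2)[of "(c + t *\<^sub>R v) + s *\<^sub>R u"] norm_le(1)[of s] s t by (simp add: algebra_simps)
    also have "\<dots> \<le> e / 4 * (2 * t)"
      using norm_le(1)[of s] s \<open>e > 0\<close> by (intro mult_left_mono) auto
    finally have b1: "\<bar>?P ((c + t *\<^sub>R v) + s *\<^sub>R u) - ?P c - (D (s *\<^sub>R u) + t * D v)\<bar> \<le> e / 4 * (2 * t)"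
      by (simp add: add scaleR)
    have "\<bar>?P (c + s *\<^sub>R u) - ?P c - D (s *\<^sub>R u)\<bar> \<le> e / 4 * norm (s *\<^sub>R u)"
      using \<delta>(2)[of "c + s *\<^sub>R u"] norm_le(2)[of s] s t by simp
    also have "\<dots> \<le> e / 4 * t"
      using norm_le(2)[of s] s \<open>e > 0\<close> by (intro mult_left_mono) auto
    finally have b2: "\<bar>?P (c + s *\<^sub>R u) - ?P c - D (s *\<^sub>R u)\<bar> \<le> e / 4 * t" .
    have "\<bar>(?P ((c + t *\<^sub>R v) + s *\<^sub>R u) - ?P (c + s *\<^sub>R u)) - t * D v\<bar> \<le> e / 4 * (2 * t) + e / 4 * t"
      using b1 b2 by linarith
    also have "\<dots> < e * t" using \<open>e > 0\<close> t(1) by simp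
    also have "(?P ((c + t *\<^sub>R v) + s *\<^sub>R u) - ?P (c + s *\<^sub>R u)) - t * D v = (?q t - D v) * t"
      unfolding q using t(1) by (simp add: field_simps)
    finally have "\<bar>(?q t - D v) * t\<bar> < e * t" .
    then show ?thesis using t(1) by (simp add: abs_mult dist_real_def)
  qed
  have "\<forall>\<^sub>F t in at_right 0. t < min \<delta> \<epsilon> / 2"
    by (rule order_tendstoD(2)[OF tendsto_ident_at]) (use \<delta>(1) \<epsilon>(1) in simp)
  moreover have "\<forall>\<^sub>F t::real in at_right 0. 0 < t"
    by (simp add: eventually_at_filter)
  ultimately show "\<forall>\<^sub>F t in at_right 0. dist (?q t) (partial_deriv j ?P c) < e"
    unfolding Dv by eventually_elim (auto intro!: close)
qed

text \<open>The second difference quotient is symmetric in the two directions, so both mixed derivatives are its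
limit.\<close>

theorem young_mixed_partials:
  fixes h :: "real^'d::finite \<Rightarrow> real"
  assumes "\<forall>\<^sub>F x in nhds c. h differentiable (at x)"
    and "partial_deriv i h differentiable (at c)" "partial_deriv j h differentiable (at c)"
  shows "partial_deriv i (partial_deriv j h) c = partial_deriv j (partial_deriv i h) c"
proof (rule tendsto_unique)
  show "((\<lambda>t. (h (c + t *\<^sub>R axis i 1 + t *\<^sub>R axis j 1) - h (c + t *\<^sub>R axis i 1)
      - h (c + t *\<^sub>R axis j 1) + h c) / t\<^sup>2) \<longlongrightarrow> partial_deriv j (partial_deriv i h) c) (at_right 0)"
    by (rule second_difference_quotient_tendsto[OF assms(1,2)])
  have "(\<lambda>t. (h (c + t *\<^sub>R axis i 1 + t *\<^sub>R axis j 1) - h (c + t *\<^sub>R axis i 1)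
      - h (c + t *\<^sub>R axis j 1) + h c) / t\<^sup>2) =
    (\<lambda>t. (h (c + t *\<^sub>R axis j 1 + t *\<^sub>R axis i 1) - h (c + t *\<^sub>R axis j 1)
      - h (c + t *\<^sub>R axis i 1) + h c) / t\<^sup>2)"
    by (simp add: fun_eq_iff algebra_simps)
  then show "((\<lambda>t. (h (c + t *\<^sub>R axis i 1 + t *\<^sub>R axis j 1) - h (c + t *\<^sub>R axis i 1)
      - h (c + t *\<^sub>R axis j 1) + h c) / t\<^sup>2) \<longlongrightarrow> partial_deriv i (partial_deriv j h) c) (at_right 0)"
    using second_difference_quotient_tendsto[OF assms(1,3), of i] by simp
qed simp

lemma mixed_partial_swap:
  assumes "times_differentiable_at (length (is @ i # j # js)) f x"
  shows "mixed_partial (is @ i # j # js) f x = mixed_partial (is @ j # i # js) f x"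
  using assms
proof (induction "is" arbitrary: x)
  case Nil
  then have f: "times_differentiable_at (Suc (Suc (length js))) f x" by simp
  then have "\<forall>\<^sub>F y in nhds x. times_differentiable_at (Suc (length js)) f y" by simp
  then have "\<forall>\<^sub>F y in nhds x. mixed_partial js f differentiable (at y)"
    by eventually_elim (auto intro: mixed_partial_differentiable)
  moreover have "partial_deriv k (mixed_partial js f) differentiable (at x)" for k
    using mixed_partial_differentiable[OF f, of "k # js"] by simp
  ultimately show ?case by (simp add: young_mixed_partials)
next
  case (Cons k "is")
  then have "\<forall>\<^sub>F y in nhds x. times_differentiable_at (length (is @ i # j # js)) f y" by simp
  then have "\<forall>\<^sub>F y in nhds x. mixed_partial (is @ i # j # js) f y = mixed_partial (is @ j # i # js) f y"
    by eventually_elim (rule Cons.IH)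
  then show ?case by (simp add: partial_deriv_cong_nhds)
qed

lemma mixed_partial_move_front:
  assumes "times_differentiable_at (length (is @ i # js)) f x"
  shows "mixed_partial (is @ i # js) f x = mixed_partial (i # is @ js) f x"
  using assms
proof (induction "is" arbitrary: js rule: rev_induct)
  case (snoc k "is")
  have "mixed_partial (is @ k # i # js) f x = mixed_partial (is @ i # k # js) f x"
    using snoc.prems by (intro mixed_partial_swap) simp
  then show ?case using snoc.IH[of "k # js"] snoc.prems by simp
qed simp

text \<open>Differentiability of order \<open>length is\<close> at \<open>x\<close> gives only one order less near \<open>x\<close>. The induction removes the outermost direction \<open>i\<close>, permutes the others
near \<open>x\<close>, and then moves \<open>i\<close> to its place by adjacent swaps.\<close>

lemma mixed_partial_cong_mset:
  assumes "mset is = mset js" "times_differentiable_at (length is) f x"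
  shows "mixed_partial is f x = mixed_partial js f x"
  using assms
proof (induction "is" arbitrary: js x)
  case (Cons i "is")
  then obtain as bs where js: "js = as @ i # bs"
    by (metis list.set_intros(1) mset_eq_setD split_list)
  with Cons.prems(1) have m: "mset is = mset (as @ bs)" by simp
  from Cons.prems have "\<forall>\<^sub>F y in nhds x. times_differentiable_at (length is) f y" by simp
  then have "\<forall>\<^sub>F y in nhds x. mixed_partial is f y = mixed_partial (as @ bs) f y"
    by eventually_elim (rule Cons.IH[OF m])
  then have "mixed_partial (i # is) f x = mixed_partial (i # as @ bs) f x"
    by (simp add: partial_deriv_cong_nhds)
  also have "\<dots> = mixed_partial js f x"
    unfolding js using Cons.prems by (intro mixed_partial_move_front[symmetric])
      (metis js mset_eq_length)
  finally show ?case .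
qed simp

section \<open>Action of the symmetrizer matrix\<close>

lemma symmetrizer_carrier: "symmetrizer d r \<in> carrier_mat (d ^ r) (d ^ r)"
  using is_symmetrizer_symmetrizer by (simp add: is_symmetrizer_def)

text \<open>The standard basis consists of Kronecker products; hence the identity that determines the symmetrizer
on Kronecker products gives its entries.\<close>

lemma kron_list_unit_vecs:
  assumes "b < d ^ r"
  shows "kron_list (map (unit_vec d) (multi_index d r b)) = unit_vec (d ^ r) b"
proof (rule eq_vecI)
  let ?m = "multi_index d r" and ?vs = "map (unit_vec d) (multi_index d r b) :: real Matrix.vec list"
  have vs: "length ?vs = r" "set ?vs \<subseteq> carrier_vec d" by auto
  have dig: "?m k ! j < d" if "k < d ^ r" "j < r" for k j
    using set_multi_index[OF that(1)] that(2) by (metis length_multi_index lessThan_iff nth_mem subsetD)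
  fix k assume "k < dim_vec (unit_vec (d ^ r) b :: real Matrix.vec)"
  then have k: "k < d ^ r" by simp
  have "kron_list ?vs $ k = (\<Prod>j<r. if ?m k ! j = ?m b ! j then 1 else 0)"
    using kron_list_index(2)[OF vs(2), of k] k dig[OF k] dig[OF assms] by simp
  also have "\<dots> = (if ?m k = ?m b then 1 else 0)"
    by (auto simp: list_eq_iff_nth_eq)
  also have "\<dots> = (if k = b then 1 else 0)"
    using multi_index_inj[OF k assms] by auto
  finally show "kron_list ?vs $ k = unit_vec (d ^ r) b $ k" using k assms by simp
next
  show "dim_vec (kron_list (map (unit_vec d) (multi_index d r b))) = dim_vec (unit_vec (d ^ r) b)"
    using kron_list_index(1)[of "map (unit_vec d) (multi_index d r b)" d]
    by (simp add: image_subset_iff)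
qed

text \<open>If the entries of \<open>v\<close> are read as a function \<open>V\<close> of the digits of their index, the symmetrizer averages
\<open>V\<close> over all permutations of the digits.\<close>

lemma symmetrizer_mult_vec:
  assumes a: "a < d ^ r"
    and V: "\<And>b. b < d ^ r \<Longrightarrow> v $ b = V (multi_index d r b)"
    and v: "v \<in> carrier_vec (d ^ r)"
  shows "fact r * (symmetrizer d r *\<^sub>v v) $ a =
    (\<Sum>\<sigma> | \<sigma> permutes {0..<r}. V (map (\<lambda>j. multi_index d r a ! \<sigma> j) [0..<r]))"
proof -
  let ?m = "multi_index d r" and ?S = "symmetrizer d r" and ?P = "{\<sigma>. \<sigma> permutes {0..<r}}"
  have dig: "?m k ! j < d" if "k < d ^ r" "j < r" for k j
    using set_multi_index[OF that(1)] that(2) by (metis length_multi_index lessThan_iff nth_mem subsetD)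
  have perm_less: "\<sigma> j < r" if "\<sigma> \<in> ?P" "j < r" for \<sigma> j
    using that permutes_in_image[of \<sigma> "{0..<r}" j] by simp
  have entry: "fact r * ?S $$ (a, b) = (\<Sum>\<sigma>\<in>?P. if ?m b = map (\<lambda>j. ?m a ! \<sigma> j) [0..<r] then 1 else 0)"
    if b: "b < d ^ r" for b
  proof -
    let ?vs = "map (unit_vec d) (?m b) :: real Matrix.vec list"
    have vs: "length ?vs = r" "set ?vs \<subseteq> carrier_vec d" by auto
    let ?K = "\<lambda>\<sigma>. kron_list (map (\<lambda>j. ?vs ! \<sigma> j) [0..<r])"
    have setp: "set (map (\<lambda>j. ?vs ! \<sigma> j) [0..<r]) \<subseteq> carrier_vec d" if "\<sigma> \<in> ?P" for \<sigma>
      using perm_less[OF that] by auto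
    have K: "?K \<in> ?P \<rightarrow> carrier_vec (d ^ r)"
      using kron_list_index(1)[OF setp] by auto
    have "fact r \<cdot>\<^sub>v (?S *\<^sub>v unit_vec (d ^ r) b) = finsum_vec TYPE(real) (d ^ r) ?K ?P"
      using is_symmetrizer_symmetrizer[of d r] vs kron_list_unit_vecs[OF b]
      unfolding is_symmetrizer_def by metis
    moreover have "(fact r \<cdot>\<^sub>v (?S *\<^sub>v unit_vec (d ^ r) b)) $ a = fact r * ?S $$ (a, b)"
      using symmetrizer_carrier[of d r] a b by simp
    moreover have "finsum_vec TYPE(real) (d ^ r) ?K ?P $ a = (\<Sum>\<sigma>\<in>?P. ?K \<sigma> $ a)"
      by (rule index_finsum_vec[OF _ a K]) (simp add: finite_permutations)
    ultimately have "fact r * ?S $$ (a, b) = (\<Sum>\<sigma>\<in>?P. ?K \<sigma> $ a)" by simp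
    also have "\<dots> = (\<Sum>\<sigma>\<in>?P. if ?m b = map (\<lambda>j. ?m a ! inv_into UNIV \<sigma> j) [0..<r] then 1 else 0)"
    proof (rule sum.cong[OF refl])
      fix \<sigma> assume s: "\<sigma> \<in> ?P"
      then have per: "\<sigma> permutes {0..<r}" by simp
      have "(\<forall>j\<in>{0..<r}. ?m a ! j = ?m b ! \<sigma> j) \<longleftrightarrow>
          (\<forall>j\<in>\<sigma> ` {0..<r}. ?m a ! inv_into UNIV \<sigma> j = ?m b ! j)"
        using permutes_inverses(2)[OF per] by simp
      also have "\<dots> \<longleftrightarrow> ?m b = map (\<lambda>j. ?m a ! inv_into UNIV \<sigma> j) [0..<r]"
        unfolding permutes_image[OF per] by (auto simp: list_eq_iff_nth_eq)
      finally have iff: "(\<forall>j<r. ?m a ! j = ?m b ! \<sigma> j) \<longleftrightarrow>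
          ?m b = map (\<lambda>j. ?m a ! inv_into UNIV \<sigma> j) [0..<r]"
        by (simp add: Ball_def)
      have "?K \<sigma> $ a = (\<Prod>j<r. if ?m a ! j = ?m b ! \<sigma> j then 1 else 0)"
        using kron_list_index(2)[OF setp[OF s], of a] a dig[OF a] dig[OF b] perm_less[OF s] by simp
      also have "\<dots> = (if \<forall>j<r. ?m a ! j = ?m b ! \<sigma> j then 1 else 0)" by auto
      finally show "?K \<sigma> $ a = (if ?m b = map (\<lambda>j. ?m a ! inv_into UNIV \<sigma> j) [0..<r] then 1 else 0)"
        unfolding iff .
    qed
    \<comment> \<open>The defining identity permutes the digits of \<open>b\<close>; solving for them brings in the inverse permutation, which the sum over all permutations absorbs.\<close>
    also have "\<dots> = (\<Sum>\<sigma>\<in>?P. if ?m b = map (\<lambda>j. ?m a ! \<sigma> j) [0..<r] then 1 else 0)"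
      by (rule sum_permutations_inverse[symmetric])
    finally show ?thesis .
  qed
  have indicator: "(if Q then 1 else 0) * x = (if Q then x else 0)" for Q and x :: real by simp
  have "fact r * (?S *\<^sub>v v) $ a = (\<Sum>b<d ^ r. fact r * ?S $$ (a, b) * v $ b)"
    using a v symmetrizer_carrier[of d r]
    by (simp add: scalar_prod_def atLeast0LessThan sum_distrib_left mult.assoc)
  also have "\<dots> = (\<Sum>b<d ^ r. \<Sum>\<sigma>\<in>?P. if ?m b = map (\<lambda>j. ?m a ! \<sigma> j) [0..<r] then v $ b else 0)"
  proof (rule sum.cong[OF refl])
    fix b assume "b \<in> {..<d ^ r}"
    then have "fact r * ?S $$ (a, b) * v $ b =
        (\<Sum>\<sigma>\<in>?P. (if ?m b = map (\<lambda>j. ?m a ! \<sigma> j) [0..<r] then 1 else 0) * v $ b)"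
      by (simp only: entry lessThan_iff sum_distrib_right)
    also have "\<dots> = (\<Sum>\<sigma>\<in>?P. if ?m b = map (\<lambda>j. ?m a ! \<sigma> j) [0..<r] then v $ b else 0)"
      by (simp only: indicator)
    finally show "fact r * ?S $$ (a, b) * v $ b = \<dots>" .
  qed
  also have "\<dots> = (\<Sum>\<sigma>\<in>?P. \<Sum>b<d ^ r. if ?m b = map (\<lambda>j. ?m a ! \<sigma> j) [0..<r] then v $ b else 0)"
    by (rule sum.swap)
  also have "\<dots> = (\<Sum>\<sigma>\<in>?P. V (map (\<lambda>j. ?m a ! \<sigma> j) [0..<r]))"
  proof (rule sum.cong[OF refl])
    fix \<sigma> assume s: "\<sigma> \<in> ?P"
    let ?is = "map (\<lambda>j. ?m a ! \<sigma> j) [0..<r]"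
    have "set ?is \<subseteq> {..<d}" using dig[OF a] perm_less[OF s] by auto
    from multi_index_encode[OF this] obtain b where b: "b < d ^ r" "?m b = ?is"
      unfolding length_map length_upt minus_nat.diff_0 by blast
    have "(\<Sum>k<d ^ r. if ?m k = ?is then v $ k else 0) = (\<Sum>k<d ^ r. if k = b then v $ k else 0)"
    proof (rule sum.cong[OF refl])
      fix k assume "k \<in> {..<d ^ r}"
      then have "?m k = ?is \<longleftrightarrow> k = b"
        using multi_index_inj[of k d r b, OF _ b(1)] b(2) unfolding lessThan_iff by argo
      then show "(if ?m k = ?is then v $ k else 0) = (if k = b then v $ k else 0)" by (rule if_cong) simp_all
    qed
    also have "\<dots> = v $ b" using b(1) by (simp add: sum.delta)
    also have "\<dots> = V ?is" unfolding V[OF b(1)] b(2) ..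
    finally show "(\<Sum>k<d ^ r. if ?m k = ?is then v $ k else 0) = V ?is" .
  qed
  finally show ?thesis .
qed

section \<open>Averaging over permutations\<close>

lemma ex_permutes_image_eq:
  assumes "finite A" "S \<subseteq> A" "T \<subseteq> A" "card S = card T"
  obtains \<pi> where "\<pi> permutes A" "\<pi> ` S = T"
proof -
  have fin: "finite S" "finite T" using assms finite_subset by auto
  obtain p where p: "bij_betw p S T"
    using finite_same_card_bij fin assms(4) by blast
  have "card (A - S) = card (A - T)"
    using assms fin by (simp add: card_Diff_subset)
  then obtain q where q: "bij_betw q (A - S) (A - T)"
    using finite_same_card_bij[of "A - S" "A - T"] assms(1) by auto
  define \<pi> where "\<pi> x = (if x \<in> S then p x else if x \<in> A then q x else x)" for x
  have 1: "bij_betw \<pi> S T" using p by (subst bij_betw_cong[of _ _ p]) (auto simp: \<pi>_def)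
  have 2: "bij_betw \<pi> (A - S) (A - T)" using q by (subst bij_betw_cong[of _ _ q]) (auto simp: \<pi>_def)
  have "bij_betw \<pi> (S \<union> (A - S)) (T \<union> (A - T))"
    by (rule bij_betw_combine[OF 1 2]) auto
  then have "bij_betw \<pi> A A"
    using assms(2,3) by (simp add: Un_absorb1)
  then have "\<pi> permutes A" using assms(2) by (intro bij_imp_permutes) (auto simp: \<pi>_def)
  then show thesis using that 1 by (auto simp: bij_betw_def)
qed

text \<open>Both sides evaluate the double sum of \<open>\<phi> (\<sigma> ` T)\<close> over all permutations \<open>\<sigma>\<close> of \<open>A\<close> and all subsets \<open>T\<close> of the
size of \<open>S\<close>. For fixed \<open>T\<close>, the sum over \<open>\<sigma>\<close> does not depend on \<open>T\<close>, as some permutation carries \<open>S\<close> to \<open>T\<close>;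
for fixed \<open>\<sigma>\<close>, the map \<open>T \<mapsto> \<sigma> ` T\<close> permutes the subsets. This is where the binomial coefficients of
the product rule come from.\<close>

lemma sum_permutations_image:
  fixes \<phi> :: "'a set \<Rightarrow> real"
  assumes A: "finite A" and S: "S \<subseteq> A"
  shows "real (card A choose card S) * (\<Sum>\<sigma> | \<sigma> permutes A. \<phi> (\<sigma> ` S)) =
    fact (card A) * (\<Sum>T | T \<subseteq> A \<and> card T = card S. \<phi> T)"
proof -
  let ?P = "{\<sigma>. \<sigma> permutes A}" and ?C = "{T. T \<subseteq> A \<and> card T = card S}"
  have indep: "(\<Sum>\<sigma>\<in>?P. \<phi> (\<sigma> ` T)) = (\<Sum>\<sigma>\<in>?P. \<phi> (\<sigma> ` S))" if T: "T \<in> ?C" for T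
  proof -
    obtain \<pi> where \<pi>: "\<pi> permutes A" "\<pi> ` S = T"
      using ex_permutes_image_eq[OF A S, of T] T by auto
    show ?thesis
      using sum_permutations_compose_right[OF \<pi>(1), of "\<lambda>\<sigma>. \<phi> (\<sigma> ` S)"] \<pi>(2)
      by (simp only: image_comp[symmetric])
  qed
  have reindex: "(\<Sum>T\<in>?C. \<phi> (\<sigma> ` T)) = (\<Sum>T\<in>?C. \<phi> T)" if \<sigma>: "\<sigma> \<in> ?P" for \<sigma>
  proof (rule sum.reindex_bij_betw)
    have per: "\<sigma> permutes A" using \<sigma> by simp
    have inj: "inj_on \<sigma> T" for T using permutes_inj[OF per] by (rule inj_on_subset) simp
    show "bij_betw ((`) \<sigma>) ?C ?C"
    proof (rule bij_betwI')
      fix T T' show "\<sigma> ` T = \<sigma> ` T' \<longleftrightarrow> T = T'"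
        using inj_image_eq_iff[OF permutes_inj[OF per]] .
    next
      fix T assume "T \<in> ?C"
      then show "\<sigma> ` T \<in> ?C"
        using permutes_image[OF per] card_image[OF inj] by auto
    next
      fix T assume T: "T \<in> ?C"
      then obtain U where "U \<subseteq> A" "T = \<sigma> ` U"
        using permutes_image[OF per] by (metis (mono_tags) mem_Collect_eq subset_imageE)
      then show "\<exists>U\<in>?C. T = \<sigma> ` U"
        using T card_image[OF inj] by auto
    qed
  qed
  have "real (card A choose card S) * (\<Sum>\<sigma>\<in>?P. \<phi> (\<sigma> ` S)) = (\<Sum>T\<in>?C. \<Sum>\<sigma>\<in>?P. \<phi> (\<sigma> ` T))"
    using n_subsets[OF A, of "card S"] by (simp add: indep)
  also have "\<dots> = (\<Sum>\<sigma>\<in>?P. \<Sum>T\<in>?C. \<phi> (\<sigma> ` T))" by (rule sum.swap)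
  also have "\<dots> = fact (card A) * (\<Sum>T\<in>?C. \<phi> T)"
    using card_permutations[OF refl A] by (simp add: reindex)
  finally show ?thesis .
qed

section \<open>The product rule for scalar functions\<close>

text \<open>After the positions have been permuted by \<open>\<sigma>\<close>, the last \<open>r - m\<close> of them are those of the set
\<open>\<sigma> ` {m..<r}\<close>, in some order. This matches a permuted index, cut in two by a Kronecker product, with a term
of the Leibniz sum over subsets.\<close>

lemma mset_map_permutes_filter:
  assumes \<sigma>: "\<sigma> permutes {0..<r}" and m: "m \<le> r"
  shows "mset (map \<sigma> [0..<m]) = mset (filter (\<lambda>k. k \<notin> \<sigma> ` {m..<r}) [0..<r])"
    and "mset (map \<sigma> [m..<r]) = mset (filter (\<lambda>k. k \<in> \<sigma> ` {m..<r}) [0..<r])"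
proof -
  have inj: "inj_on \<sigma> X" for X using permutes_inj[OF \<sigma>] by (rule inj_on_subset) simp
  have "{0..<r} = \<sigma> ` ({0..<m} \<union> {m..<r})"
    using m permutes_image[OF \<sigma>] by (simp add: ivl_disj_un)
  moreover have "\<sigma> ` {0..<m} \<inter> \<sigma> ` {m..<r} = {}"
    using inj_on_image_Int[OF inj[of UNIV], of "{0..<m}" "{m..<r}"] by simp
  ultimately have "\<sigma> ` {0..<m} = {k \<in> {0..<r}. k \<notin> \<sigma> ` {m..<r}}"
    and "\<sigma> ` {m..<r} = {k \<in> {0..<r}. k \<in> \<sigma> ` {m..<r}}" by blast+
  then show "mset (map \<sigma> [0..<m]) = mset (filter (\<lambda>k. k \<notin> \<sigma> ` {m..<r}) [0..<r])"
    and "mset (map \<sigma> [m..<r]) = mset (filter (\<lambda>k. k \<in> \<sigma> ` {m..<r}) [0..<r])"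
    by (subst set_eq_iff_mset_eq_distinct[symmetric]; simp add: distinct_map inj)+
qed

lemma multi_index_add:
  assumes "d > 0"
  shows "multi_index d (m + n) k = multi_index d m (k div d ^ n) @ multi_index d n (k mod d ^ n)"
proof (induction m arbitrary: k)
  case 0
  show ?case
  proof (cases n)
    case (Suc l)
    have "k mod (d * d ^ l) div d ^ l mod d = k div d ^ l mod d"
      using mod_mult2_eq[of k "d ^ l" d] assms by (simp add: mult.commute)
    then show ?thesis by (simp add: Suc multi_index_Suc mod_mod_cancel)
  qed simp
next
  case (Suc m)
  have e: "k mod d ^ (m + n) = d ^ n * (k div d ^ n mod d ^ m) + k mod d ^ n"
    using mod_mult2_eq[of k "d ^ n" "d ^ m"] by (simp add: power_add mult.commute)
  have "k mod d ^ (m + n) div d ^ n = k div d ^ n mod d ^ m"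
    unfolding e using assms by simp
  moreover have "k mod d ^ (m + n) mod d ^ n = k mod d ^ n"
    by (rule mod_mod_cancel) (simp add: power_add)
  moreover have "k div d ^ (m + n) = k div d ^ n div d ^ m"
    using div_mult2_eq[of k "d ^ n" "d ^ m"] by (simp add: power_add mult.commute)
  ultimately show ?case by (simp add: multi_index_Suc Suc.IH)
qed

text \<open>The leading \<open>r - j\<close> digits of an index of a Kronecker product address the first factor and the other \<open>j\<close>
digits the second.\<close>

lemma tensor_deriv_kron_index:
  fixes f g :: "real^'d::{finite, linorder} \<Rightarrow> real"
  assumes b: "b < CARD('d) ^ r" and j: "j \<le> r"
  shows "(tensor_deriv (r - j) f c \<otimes>\<^sub>v tensor_deriv j g c) $ b =
    mixed_partial (map coord (take (r - j) (multi_index CARD('d) r b))) f c *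
    mixed_partial (map coord (drop (r - j) (multi_index CARD('d) r b))) g c"
proof -
  let ?d = "CARD('d)"
  have r: "?d ^ (r - j) * ?d ^ j = ?d ^ r"
    using j by (simp flip: power_add)
  have m: "multi_index ?d r b = multi_index ?d (r - j) (b div ?d ^ j) @ multi_index ?d j (b mod ?d ^ j)"
    using multi_index_add[of ?d "r - j" j b] j by simp
  have "b div ?d ^ j < ?d ^ (r - j)" "b mod ?d ^ j < ?d ^ j"
    using div_less_mult[of b "?d ^ (r - j)" "?d ^ j"] b by (simp_all add: r)
  then show ?thesis
    using b by (simp add: m kron_vec_def tensor_deriv_def r)
qed

lemma tensor_deriv_kron_carrier:
  fixes f g :: "real^'d::{finite, linorder} \<Rightarrow> real"
  assumes "j \<le> r"
  shows "tensor_deriv (r - j) f c \<otimes>\<^sub>v tensor_deriv j g c \<in> carrier_vec (CARD('d) ^ r)"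
proof -
  have "CARD('d) ^ (r - j) * CARD('d) ^ j = CARD('d) ^ r"
    using assms by (simp flip: power_add)
  then show ?thesis
    by (intro carrier_vecI) (simp only: kron_vec_def tensor_deriv_def dim_vec)
qed

text \<open>Fix an entry and let \<open>\<phi> T\<close> be the term of the Leibniz sum for the set \<open>T\<close> of positions whose derivatives fall
on \<open>g\<close>. By the symmetry of mixed partial derivatives, permuting the digits by \<open>\<sigma>\<close> turns the entry of the
\<open>j\<close>-th summand into \<open>\<phi> (\<sigma> ` {r - j..<r})\<close>; the average over \<open>\<sigma>\<close>, multiplied by \<open>r choose j\<close>, is the
sum of \<open>\<phi>\<close> over all \<open>j\<close>-element sets.\<close>

theorem tensor_deriv_mult:
  fixes f g :: "real^'d::{finite, linorder} \<Rightarrow> real"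
  assumes f: "times_differentiable_at r f c" and g: "times_differentiable_at r g c"
  shows "tensor_deriv r (\<lambda>x. f x * g x) c =
    symmetrizer CARD('d) r *\<^sub>v finsum_vec TYPE(real) (CARD('d) ^ r)
      (\<lambda>j. real (r choose j) \<cdot>\<^sub>v (tensor_deriv (r - j) f c \<otimes>\<^sub>v tensor_deriv j g c)) {0..r}"
    (is "_ = ?S *\<^sub>v ?v")
proof (rule eq_vecI)
  let ?d = "CARD('d)" and ?m = "multi_index CARD('d) r"
  let ?K = "\<lambda>j. real (r choose j) \<cdot>\<^sub>v (tensor_deriv (r - j) f c \<otimes>\<^sub>v tensor_deriv j g c)"
  let ?P = "{\<sigma>. \<sigma> permutes {0..<r}}"
  have K: "?K \<in> {0..r} \<rightarrow> carrier_vec (?d ^ r)"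
    using tensor_deriv_kron_carrier by auto
  have v: "?v \<in> carrier_vec (?d ^ r)" by (rule finsum_vec_closed[OF K])
  show "dim_vec (tensor_deriv r (\<lambda>x. f x * g x) c) = dim_vec (?S *\<^sub>v ?v)"
    using symmetrizer_carrier[of ?d r] by (simp add: tensor_deriv_def)
  fix a assume "a < dim_vec (?S *\<^sub>v ?v)"
  then have a: "a < ?d ^ r" using symmetrizer_carrier[of ?d r] by simp
  define w :: "nat \<Rightarrow> 'd" where "w i = coord (?m a ! i)" for i
  define \<phi> where "\<phi> T = mixed_partial (map w (filter (\<lambda>k. k \<notin> T) [0..<r])) f c *
    mixed_partial (map w (filter (\<lambda>k. k \<in> T) [0..<r])) g c" for T
  define V where "V is = (\<Sum>j = 0..r. real (r choose j) *
    (mixed_partial (map coord (take (r - j) is)) f c * mixed_partial (map coord (drop (r - j) is)) g c))" for "is"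
  have leibniz: "tensor_deriv r (\<lambda>x. f x * g x) c $ a = (\<Sum>T\<in>Pow {0..<r}. \<phi> T)"
  proof -
    have "map coord (?m a) = map w [0..<r]"
      by (rule nth_equalityI) (simp_all add: w_def)
    then show ?thesis
      using a mixed_partial_mult[of "[0..<r]" f c g w] f g by (simp add: tensor_deriv_def \<phi>_def)
  qed
  have summand: "mixed_partial (map coord (take (r - j) (map (\<lambda>i. ?m a ! \<sigma> i) [0..<r]))) f c *
      mixed_partial (map coord (drop (r - j) (map (\<lambda>i. ?m a ! \<sigma> i) [0..<r]))) g c =
      \<phi> (\<sigma> ` {r - j..<r})" if \<sigma>: "\<sigma> \<in> ?P" for \<sigma> j
  proof -
    have per: "\<sigma> permutes {0..<r}" using \<sigma> by simp
    have m: "mset (map w (map \<sigma> [0..<r - j])) = mset (map w (filter (\<lambda>k. k \<notin> \<sigma> ` {r - j..<r}) [0..<r]))"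
      "mset (map w (map \<sigma> [r - j..<r])) = mset (map w (filter (\<lambda>k. k \<in> \<sigma> ` {r - j..<r}) [0..<r]))"
      using mset_map_permutes_filter[OF per, of "r - j"] by (simp_all only: mset_map diff_le_self)
    have "mixed_partial (map w (map \<sigma> [0..<r - j])) f c * mixed_partial (map w (map \<sigma> [r - j..<r])) g c
        = \<phi> (\<sigma> ` {r - j..<r})"
      unfolding \<phi>_def
      by (intro arg_cong2[where f = "(*)"] mixed_partial_cong_mset m
        times_differentiable_at_mono[OF f] times_differentiable_at_mono[OF g]) simp_all
    then show ?thesis by (simp add: w_def o_def take_map drop_map take_upt)
  qed
  have "fact r * (?S *\<^sub>v ?v) $ a = (\<Sum>\<sigma>\<in>?P. V (map (\<lambda>i. ?m a ! \<sigma> i) [0..<r]))"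
  proof (rule symmetrizer_mult_vec[OF a _ v])
    fix b assume b: "b < ?d ^ r"
    have "?v $ b = (\<Sum>j = 0..r. ?K j $ b)"
      by (rule index_finsum_vec[OF _ b K]) simp
    also have "\<dots> = V (?m b)"
      unfolding V_def
    proof (rule sum.cong[OF refl])
      fix j assume "j \<in> {0..r}"
      then have j: "j \<le> r" by simp
      show "?K j $ b = real (r choose j) * (mixed_partial (map coord (take (r - j) (?m b))) f c *
          mixed_partial (map coord (drop (r - j) (?m b))) g c)"
        using tensor_deriv_kron_carrier[OF j, of f c g] tensor_deriv_kron_index[OF b j, of f c g] b
        by simp
    qed
    finally show "?v $ b = V (?m b)" .
  qed
  also have "\<dots> = (\<Sum>\<sigma>\<in>?P. \<Sum>j = 0..r. real (r choose j) * \<phi> (\<sigma> ` {r - j..<r}))"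
    unfolding V_def by (intro sum.cong refl arg_cong2[where f = "(*)"] summand)
  also have "\<dots> = (\<Sum>j = 0..r. real (r choose j) * (\<Sum>\<sigma>\<in>?P. \<phi> (\<sigma> ` {r - j..<r})))"
    by (subst sum.swap) (simp only: sum_distrib_left)
  also have "\<dots> = (\<Sum>j = 0..r. fact r * (\<Sum>T | T \<in> Pow {0..<r} \<and> card T = j. \<phi> T))"
  proof (rule sum.cong[OF refl])
    fix j assume "j \<in> {0..r}"
    then show "real (r choose j) * (\<Sum>\<sigma>\<in>?P. \<phi> (\<sigma> ` {r - j..<r})) =
        fact r * (\<Sum>T | T \<in> Pow {0..<r} \<and> card T = j. \<phi> T)"
      using sum_permutations_image[of "{0..<r}" "{r - j..<r}" \<phi>] by simp
  qed
  also have "\<dots> = fact r * (\<Sum>j = 0..r. \<Sum>T | T \<in> Pow {0..<r} \<and> card T = j. \<phi> T)"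
    by (simp only: sum_distrib_left)
  also have "(\<Sum>j = 0..r. \<Sum>T | T \<in> Pow {0..<r} \<and> card T = j. \<phi> T) = (\<Sum>T\<in>Pow {0..<r}. \<phi> T)"
  proof (rule sum.group)
    show "card ` Pow {0..<r} \<subseteq> {0..r}"
      using card_mono[of "{0..<r}"] by auto
  qed simp_all
  finally show "tensor_deriv r (\<lambda>x. f x * g x) c $ a = (?S *\<^sub>v ?v) $ a"
    by (simp add: leibniz)
qed

section \<open>The product rule for vector-valued functions\<close>

text \<open>The matrix \<open>1\<^sub>m m \<otimes>\<^sub>m S\<close> is block diagonal and applies \<open>S\<close> to each of the \<open>m\<close> blocks of \<open>v\<close> of length \<open>n\<close>.\<close>

lemma one_kron_mat_mult_vec_index:
  assumes S: "S \<in> carrier_mat n n" and v: "v \<in> carrier_vec (m * n)" and k: "k < m" and a: "a < n"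
  shows "((1\<^sub>m m \<otimes>\<^sub>m S) *\<^sub>v v) $ (k * n + a) = (S *\<^sub>v Matrix.vec n (\<lambda>b. v $ (k * n + b))) $ a"
proof -
  have K: "k * n + a < m * n" using index_stack_less[OF a k] by (simp add: mult.commute)
  have n: "n > 0" using a by simp
  have "((1\<^sub>m m \<otimes>\<^sub>m S) *\<^sub>v v) $ (k * n + a) =
      (\<Sum>l<m * n. (if l div n = k then 1 else 0) * S $$ (a, l mod n) * v $ l)"
    using S v K k a n
    by (simp add: kron_mat_def scalar_prod_def atLeast0LessThan less_mult_imp_div_less)
      (rule sum.cong, auto simp: less_mult_imp_div_less)
  also have "\<dots> = (\<Sum>l\<in>(\<lambda>b. k * n + b) ` {..<n}. (if l div n = k then 1 else 0) * S $$ (a, l mod n) * v $ l)"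
  proof (rule sum.mono_neutral_right)
    show "(\<lambda>b. k * n + b) ` {..<n} \<subseteq> {..<m * n}"
      using index_stack_less[OF _ k, of _ n] by (auto simp: mult.commute[of n])
    show "\<forall>l\<in>{..<m * n} - (\<lambda>b. k * n + b) ` {..<n}.
        (if l div n = k then 1 else 0) * S $$ (a, l mod n) * v $ l = 0"
    proof
      fix l assume l: "l \<in> {..<m * n} - (\<lambda>b. k * n + b) ` {..<n}"
      have "l = l div n * n + l mod n" by simp
      then have "l div n \<noteq> k" using l n by (metis DiffD2 imageI lessThan_iff mod_less_divisor)
      then show "(if l div n = k then 1 else 0) * S $$ (a, l mod n) * v $ l = 0" by simp
    qed
  qed simp
  also have "\<dots> = (\<Sum>b<n. S $$ (a, b) * v $ (k * n + b))"
    by (subst sum.reindex) (simp_all add: inj_on_def)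
  also have "\<dots> = (S *\<^sub>v Matrix.vec n (\<lambda>b. v $ (k * n + b))) $ a"
    using S a by (simp add: scalar_prod_def atLeast0LessThan)
  finally show ?thesis .
qed

text \<open>Stacking the derivatives of the components and undoing \<open>vec\<close> puts one component in each column.\<close>

lemma mat_of_vec_tensor_deriv:
  fixes F :: "real^'d::{finite, linorder} \<Rightarrow> real Matrix.vec"
  shows "mat_of_vec (CARD('d) ^ n) p (vec_tensor_deriv p n F c) =
    Matrix.mat (CARD('d) ^ n) p (\<lambda>(i, k). tensor_deriv n (\<lambda>x. F x $ k) c $ i)"
proof -
  have "vec_tensor_deriv p n F c \<in> carrier_vec (CARD('d) ^ n * p)"
    by (intro carrier_vecI) (simp only: vec_tensor_deriv_def dim_vec mult.commute)
  moreover have "k * CARD('d) ^ n + i < p * CARD('d) ^ n" if "i < CARD('d) ^ n" "k < p" for i k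
    using index_stack_less[OF that] by (simp add: mult.commute)
  ultimately show ?thesis
    by (subst mat_of_vec_eq) (auto simp: vec_tensor_deriv_def intro!: eq_matI)
qed

text \<open>A column of a Kronecker product of matrices is the Kronecker product of two columns, here the derivatives of
a component of \<open>F\<close> and of a component of \<open>G\<close>. Vectorization makes these columns the blocks on which
the block diagonal matrix acts.\<close>

lemma vec_kron_tensor_deriv:
  fixes F G :: "real^'d::{finite, linorder} \<Rightarrow> real Matrix.vec"
    and c :: "real^'d::{finite, linorder}" and p q r j :: nat
  assumes j: "j \<le> r"
  defines "M \<equiv> vec_of_mat (mat_of_vec (CARD('d) ^ (r - j)) p (vec_tensor_deriv p (r - j) F c)
    \<otimes>\<^sub>m mat_of_vec (CARD('d) ^ j) q (vec_tensor_deriv q j G c))"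
  shows "M \<in> carrier_vec (p * q * CARD('d) ^ r)"
    and "k < p * q \<Longrightarrow> b < CARD('d) ^ r \<Longrightarrow> M $ (k * CARD('d) ^ r + b) =
      (tensor_deriv (r - j) (\<lambda>x. F x $ (k div q)) c \<otimes>\<^sub>v tensor_deriv j (\<lambda>x. G x $ (k mod q)) c) $ b"
proof -
  let ?d = "CARD('d)"
  have r: "?d ^ (r - j) * ?d ^ j = ?d ^ r"
    using j by (simp flip: power_add)
  show "M \<in> carrier_vec (p * q * CARD('d) ^ r)"
    by (intro carrier_vecI) (simp only: M_def mat_of_vec_tensor_deriv vec_of_mat_def kron_mat_def
      dim_vec dim_row_mat dim_col_mat r mult.commute[of _ "p * q"])
  assume k: "k < p * q" and b: "b < ?d ^ r"
  have kq: "k div q < p" "k mod q < q" using div_less_mult[OF k] by auto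
  have bd: "b div ?d ^ j < ?d ^ (r - j)" "b mod ?d ^ j < ?d ^ j"
    using div_less_mult[of b "?d ^ (r - j)" "?d ^ j"] b by (simp_all add: r)
  have "k * ?d ^ r + b < ?d ^ r * (p * q)" by (rule index_stack_less[OF b k])
  then show "M $ (k * ?d ^ r + b) =
      (tensor_deriv (r - j) (\<lambda>x. F x $ (k div q)) c \<otimes>\<^sub>v tensor_deriv j (\<lambda>x. G x $ (k mod q)) c) $ b"
    using b k kq bd
    by (simp add: M_def mat_of_vec_tensor_deriv vec_of_mat_def kron_mat_def kron_vec_def tensor_deriv_def r)
qed

text \<open>Component \<open>k\<close> of \<open>F x \<otimes>\<^sub>v G x\<close> is the product of component \<open>k div q\<close> of \<open>F\<close> and component \<open>k mod q\<close> of \<open>G\<close>,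
and block \<open>k\<close> of the right-hand side is the scalar rule for these two functions.\<close>

theorem vec_tensor_deriv_kron:
  fixes F G :: "real^'d::{finite, linorder} \<Rightarrow> real Matrix.vec"
  assumes F: "\<And>x. F x \<in> carrier_vec p" and G: "\<And>x. G x \<in> carrier_vec q"
    and dF: "vec_times_differentiable_at p r F c" and dG: "vec_times_differentiable_at q r G c"
  shows "vec_tensor_deriv (p * q) r (\<lambda>x. F x \<otimes>\<^sub>v G x) c =
    (1\<^sub>m (p * q) \<otimes>\<^sub>m symmetrizer CARD('d) r) *\<^sub>v
      finsum_vec TYPE(real) (p * q * CARD('d) ^ r)
        (\<lambda>j. real (r choose j) \<cdot>\<^sub>v
           vec_of_mat (mat_of_vec (CARD('d) ^ (r - j)) p (vec_tensor_deriv p (r - j) F c)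
             \<otimes>\<^sub>m mat_of_vec (CARD('d) ^ j) q (vec_tensor_deriv q j G c)))
        {0..r}"
    (is "_ = ?I *\<^sub>v finsum_vec _ _ ?M _")
proof (rule eq_vecI)
  let ?d = "CARD('d)" and ?S = "symmetrizer CARD('d) r"
  let ?v = "finsum_vec TYPE(real) (p * q * ?d ^ r) ?M {0..r}"
  have M: "?M \<in> {0..r} \<rightarrow> carrier_vec (p * q * ?d ^ r)"
    using vec_kron_tensor_deriv(1) by auto
  have v: "?v \<in> carrier_vec (p * q * ?d ^ r)" by (rule finsum_vec_closed[OF M])
  show "dim_vec (vec_tensor_deriv (p * q) r (\<lambda>x. F x \<otimes>\<^sub>v G x) c) = dim_vec (?I *\<^sub>v ?v)"
    using symmetrizer_carrier[of ?d r] by (simp add: vec_tensor_deriv_def kron_mat_def)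
  fix l assume "l < dim_vec (?I *\<^sub>v ?v)"
  then have l: "l < p * q * ?d ^ r"
    using symmetrizer_carrier[of ?d r] by (simp add: kron_mat_def)
  define k a where "k = l div ?d ^ r" and "a = l mod ?d ^ r"
  have k: "k < p * q" and a: "a < ?d ^ r"
    using div_less_mult[OF l] by (simp_all add: k_def a_def)
  have l_eq: "l = k * ?d ^ r + a"
    unfolding k_def a_def by (rule div_mult_mod_eq[symmetric])
  have kq: "k div q < p" "k mod q < q" using div_less_mult[OF k] by auto
  let ?f = "\<lambda>x. F x $ (k div q)" and ?g = "\<lambda>x. G x $ (k mod q)"
  let ?K = "\<lambda>j. real (r choose j) \<cdot>\<^sub>v (tensor_deriv (r - j) ?f c \<otimes>\<^sub>v tensor_deriv j ?g c)"
  have K: "?K \<in> {0..r} \<rightarrow> carrier_vec (?d ^ r)"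
    using tensor_deriv_kron_carrier by auto
  have comp: "(\<lambda>x. (F x \<otimes>\<^sub>v G x) $ k) = (\<lambda>x. ?f x * ?g x)"
    by (rule ext) (simp only: kron_vec_def carrier_vecD[OF F] carrier_vecD[OF G] index_vec[OF k])
  have block: "Matrix.vec (?d ^ r) (\<lambda>b. ?v $ (k * ?d ^ r + b)) = finsum_vec TYPE(real) (?d ^ r) ?K {0..r}"
  proof (rule eq_vecI)
    fix b assume "b < dim_vec (finsum_vec TYPE(real) (?d ^ r) ?K {0..r})"
    then have b: "b < ?d ^ r" using finsum_vec_closed[OF K] by auto
    have kb: "k * ?d ^ r + b < p * q * ?d ^ r"
      using index_stack_less[OF b k] by (simp add: mult.commute)
    have "?v $ (k * ?d ^ r + b) = (\<Sum>j = 0..r. ?M j $ (k * ?d ^ r + b))"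
      by (rule index_finsum_vec[OF _ kb M]) simp
    also have "\<dots> = (\<Sum>j = 0..r. ?K j $ b)"
    proof (rule sum.cong[OF refl])
      fix j assume "j \<in> {0..r}"
      then have j: "j \<le> r" by simp
      show "?M j $ (k * ?d ^ r + b) = ?K j $ b"
        using vec_kron_tensor_deriv[OF j, where p = p and F = F and c = c and q = q and G = G] tensor_deriv_kron_carrier[OF j, of ?f c ?g] b k kb
        by auto
    qed
    also have "\<dots> = finsum_vec TYPE(real) (?d ^ r) ?K {0..r} $ b"
      by (rule index_finsum_vec[symmetric, OF _ b K]) simp
    finally show "Matrix.vec (?d ^ r) (\<lambda>b. ?v $ (k * ?d ^ r + b)) $ b =
        finsum_vec TYPE(real) (?d ^ r) ?K {0..r} $ b" using b by simp
  qed (use finsum_vec_closed[OF K] in auto)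
  have "vec_tensor_deriv (p * q) r (\<lambda>x. F x \<otimes>\<^sub>v G x) c $ l = tensor_deriv r (\<lambda>x. ?f x * ?g x) c $ a"
    using l by (simp add: vec_tensor_deriv_def comp flip: k_def a_def)
  also have "tensor_deriv r (\<lambda>x. ?f x * ?g x) c = ?S *\<^sub>v finsum_vec TYPE(real) (?d ^ r) ?K {0..r}"
    using dF dG kq by (intro tensor_deriv_mult) (auto simp: vec_times_differentiable_at_def)
  also have "\<dots> $ a = (?I *\<^sub>v ?v) $ l"
    unfolding l_eq block[symmetric]
    by (rule one_kron_mat_mult_vec_index[OF symmetrizer_carrier v k a, symmetric])
  finally show "vec_tensor_deriv (p * q) r (\<lambda>x. F x \<otimes>\<^sub>v G x) c $ l = (?I *\<^sub>v ?v) $ l" .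
qed

theorem theorem5:
  fixes r :: nat and c :: "real^'d::{finite, linorder}"
  assumes "r \<ge> 1"
  shows "(\<forall>f g :: real^'d::{finite, linorder} \<Rightarrow> real.
            times_differentiable_at r f c \<and> times_differentiable_at r g c \<longrightarrow>
            tensor_deriv r (\<lambda>x. f x * g x) c =
              symmetrizer CARD('d) r *\<^sub>v
                finsum_vec TYPE(real) (CARD('d) ^ r)
                  (\<lambda>j. real (r choose j) \<cdot>\<^sub>v (tensor_deriv (r - j) f c \<otimes>\<^sub>v tensor_deriv j g c))
                  {0..r})
       \<and> (\<forall>(p :: nat) (q :: nat) (F :: real^'d::{finite, linorder} \<Rightarrow> real Matrix.vec) (G :: real^'d::{finite, linorder} \<Rightarrow> real Matrix.vec).
            (\<forall>x. F x \<in> carrier_vec p) \<and> (\<forall>x. G x \<in> carrier_vec q) \<and>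
            vec_times_differentiable_at p r F c \<and> vec_times_differentiable_at q r G c \<longrightarrow>
            vec_tensor_deriv (p * q) r (\<lambda>x. F x \<otimes>\<^sub>v G x) c =
              (1\<^sub>m (p * q) \<otimes>\<^sub>m symmetrizer CARD('d) r) *\<^sub>v
                finsum_vec TYPE(real) (p * q * CARD('d) ^ r)
                  (\<lambda>j. real (r choose j) \<cdot>\<^sub>v
                     vec_of_mat (mat_of_vec (CARD('d) ^ (r - j)) p (vec_tensor_deriv p (r - j) F c)
                       \<otimes>\<^sub>m mat_of_vec (CARD('d) ^ j) q (vec_tensor_deriv q j G c)))
                  {0..r})"
  using tensor_deriv_mult vec_tensor_deriv_kron by blast

end
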